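(* Suppose that $\mathcal{B}$ is a symmetric bilinear form on a Leibniz algebra $(A,\circ_A)$. Then $\mathcal{B}$ is left-invariant if and only if $$\mathcal{B}(x\circ_A y,z)=-\mathcal{B}(y,\,x\circ_A z+z\circ_A x)-\mathcal{B}(x,\,z\circ_A y),\qquad\forall x,y,z\in A.$$ Moreover, in this case, $$\mathcal{B}(x\circ_A y,z)=-\mathcal{B}(y,x\circ_A z)=-\mathcal{B}(x\circ_A z,y),\qquad\forall x,y,z\in A,$$ holds automatically.
   Context: All vector spaces are finite-dimensional over an algebraically closed field $\mathbb{K}$ of characteristic zero. A Leibniz algebra is a vector space $A$ with a bilinear multiplication $\circ_A$ such that $x\circ_A(y\circ_A z)=(x\circ_A y)\circ_A z+y\circ_A(x\circ_A z)$ for all $x,y,z\in A$. A bilinear form $\mathcal{B}$ on a Leibniz algebra $(A,\circ_A)$ is left-invariant if $\mathcal{B}(x\circ_A y,z)+\mathcal{B}(y,x\circ_A z)=0$ for all $x,y,z\in A$. *)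

theory Defs
  imports Complex_Main "HOL-Computational_Algebra.Polynomial"
begin

definition bilinear_map ::
  "('k::field \<Rightarrow> 'a::ab_group_add \<Rightarrow> 'a) \<Rightarrow> ('k \<Rightarrow> 'b::ab_group_add \<Rightarrow> 'b) \<Rightarrow> ('a \<Rightarrow> 'a \<Rightarrow> 'b) \<Rightarrow> bool"
  where "bilinear_map s t f \<longleftrightarrow>
    (\<forall>x. Vector_Spaces.linear s t (\<lambda>y. f x y)) \<and> (\<forall>y. Vector_Spaces.linear s t (\<lambda>x. f x y))"

(* The ground field is regarded as a vector space over itself via multiplication. *)
abbreviation bilinear_form ::
  "('k::field \<Rightarrow> 'a::ab_group_add \<Rightarrow> 'a) \<Rightarrow> ('a \<Rightarrow> 'a \<Rightarrow> 'k) \<Rightarrow> bool"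
  where "bilinear_form s B \<equiv> bilinear_map s (*) B"

definition symmetric_form :: "('a \<Rightarrow> 'a \<Rightarrow> 'k) \<Rightarrow> bool"
  where "symmetric_form B \<longleftrightarrow> (\<forall>x y. B x y = B y x)"

(* Left Leibniz algebras. The underlying vector space is the whole type 'a, and Basis
   is an arbitrary finite basis, witnessing finite dimensionality. *)
locale leibniz_algebra = finite_dimensional_vector_space scale Basis
  for scale :: "'k::{alg_closed_field, field_char_0} \<Rightarrow> 'a::ab_group_add \<Rightarrow> 'a"
    and Basis :: "'a set" +
  fixes lmul :: "'a \<Rightarrow> 'a \<Rightarrow> 'a"
  assumes bilinear_mult: "bilinear_map scale scale lmul"
    and leibniz: "lmul x (lmul y z) = lmul (lmul x y) z + lmul y (lmul x z)"

definition left_invariant ::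
  "('a \<Rightarrow> 'a \<Rightarrow> 'a) \<Rightarrow> ('a \<Rightarrow> 'a \<Rightarrow> 'k::ab_group_add) \<Rightarrow> bool"
  where "left_invariant lmul B \<longleftrightarrow> (\<forall>x y z. B (lmul x y) z + B y (lmul x z) = 0)"

end

theory Submission
  imports Defs
begin

text \<open>
  Put L x y z = B (x y) z + B y (x z), so that left-invariance says L = 0. By symmetry of B
  the identity of the theorem reads L x y z = - L z x y, and clearly L = 0 implies it. Conversely,
  applying it three times around the cycle gives L = - L, hence L = 0 in characteristic zero.
\<close>

theorem lemma3p13:
  fixes scale :: "'k::{alg_closed_field, field_char_0} \<Rightarrow> 'a::ab_group_add \<Rightarrow> 'a"
    and Basis :: "'a set"
    and lmul :: "'a \<Rightarrow> 'a \<Rightarrow> 'a" (infixl "\<circ>\<^sub>A" 70)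
    and B :: "'a \<Rightarrow> 'a \<Rightarrow> 'k"
  assumes "leibniz_algebra scale Basis lmul"
    and "bilinear_form scale B"
    and "symmetric_form B"
  shows "(left_invariant lmul B \<longleftrightarrow>
           (\<forall>x y z. B (x \<circ>\<^sub>A y) z = - B y (x \<circ>\<^sub>A z + z \<circ>\<^sub>A x) - B x (z \<circ>\<^sub>A y))) \<and>
         (left_invariant lmul B \<longrightarrow>
           (\<forall>x y z. B (x \<circ>\<^sub>A y) z = - B y (x \<circ>\<^sub>A z) \<and> - B y (x \<circ>\<^sub>A z) = - B (x \<circ>\<^sub>A z) y))"
proof -
  define L where "L x y z = B (x \<circ>\<^sub>A y) z + B y (x \<circ>\<^sub>A z)" for x y z
  have sym: "B x y = B y x" for x y
    using assms(3) by (simp add: symmetric_form_def)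
  \<comment> \<open>This splits the term
    \<open>B y (x \<circ>\<^sub>A z + z \<circ>\<^sub>A x)\<close>, whose two halves go to different
    instances of \<open>L\<close>.\<close>
  have add: "B x (y + z) = B x y + B x z" for x y z
  proof -
    have "Vector_Spaces.linear scale (*) (B x)"
      using assms(2) by (simp add: bilinear_map_def)
    then show ?thesis by (simp add: Vector_Spaces.linear_iff)
  qed
  have inv_iff: "left_invariant lmul B \<longleftrightarrow> (\<forall>x y z. L x y z = 0)"
    by (simp add: left_invariant_def L_def)
  have cyclic_iff: "B (x \<circ>\<^sub>A y) z = - B y (x \<circ>\<^sub>A z + z \<circ>\<^sub>A x) - B x (z \<circ>\<^sub>A y)
      \<longleftrightarrow> L x y z = - L z x y" for x y z
    \<comment> \<open>Symmetry is used at one instance only, since as a general rewrite rule it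
      could be applied back and forth. With everything moved to one side, both equations say that
      the same sum of four terms vanishes.\<close>
    unfolding L_def add sym[of "z \<circ>\<^sub>A x" y] by (subst (1 2) eq_iff_diff_eq_0) (simp add: algebra_simps)
  have "L x y z = 0" if cyclic: "\<And>x y z. L x y z = - L z x y" for x y z
  proof -
    \<comment> \<open>The chain is \<open>L x y z = - L z x y = L y z x = - L x y z\<close>; the
      sign survives because the cycle has odd length.\<close>
    have "L x y z = - L x y z"
      by (metis cyclic minus_minus)
    then have "2 * L x y z = 0" unfolding mult_2 by (metis add.right_inverse)
    then show ?thesis by simp
  qed
  then have "left_invariant lmul B \<longleftrightarrow> (\<forall>x y z. L x y z = - L z x y)"
    unfolding inv_iff by (metis neg_0_equal_iff_equal)
  \<comment> \<open>The other equality of the final claim is symmetry of \<open>B\<close>.\<close>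
  moreover have "B (x \<circ>\<^sub>A y) z = - B y (x \<circ>\<^sub>A z)" if "left_invariant lmul B" for x y z
    using that by (simp add: left_invariant_def eq_neg_iff_add_eq_0)
  ultimately show ?thesis
    unfolding cyclic_iff using sym by metis
qed

end
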